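(* Let $(d_n)_{n\ge1}$ be a sequence of strictly positive real numbers such that $$\limsup_{n\to\infty}\frac1n\left(d_1+\cdots+d_{n(n+1)/2}\right)>0,$$ and let $D=\operatorname{diag}(d_n)$ relative to an orthonormal basis $(e_n)$ of $\mathcal H$. Then $D$ cannot be obtained using the Anderson model: there do not exist a compact operator $C$ and a bounded operator $Z$ with $D=CZ-ZC$, both of the Anderson model form (described in the context) relative to $(e_n)$, with central block sizes $n\times n$. The same holds even more generally when the off-diagonal blocks $A_n,X_n$ (of size $n\times(n+1)$) and $B_n,Y_n$ (of size $(n+1)\times n$) are allowed to be arbitrary full rectangular matrices, or even if, in addition, the diagonal blocks of $C$ are allowed to be nonzero.
   Context: $\mathcal H$ is an infinite dimensional separable complex Hilbert space and $\operatorname{diag}(d_n)$ is the operator with $De_n=d_ne_n$. Anderson model form: relative to $(e_n)$, partitioned into consecutive blocks of sizes $1,2,3,\dots$, $C$ and $Z$ are block tridiagonal with all diagonal ($n\times n$) blocks equal to $0$; the $(n,n+1)$ and $(n+1,n)$ blocks of $C$ are $A_n$ and $B_n$, and the $(n,n+1)$ and $(n+1,n)$ blocks of $Z$ are $X_n$ and $Y_n$. Moreover there are scalars $a_{k,n},b_{k,n},x_{k,n},y_{k,n}$ ($1\le k\le n$) such that the only possibly nonzero entries of these blocks are: $A_n(k,k)=a_{k,n}$, $X_n(k,k+1)=x_{k,n}$, $B_n(k+1,k)=-b_{k,n}$, $Y_n(k,k)=y_{k,n}$, for $1\le k\le n$. *)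

theory Defs
  imports "HOL-Analysis.Analysis"
begin

text \<open>
  The inner product is linear in the first argument. Positive definiteness is part of
  \<open>cinner_self\<close>, and \<open>scaleC 1 x = x\<close> follows from \<open>scaleR_scaleC\<close>.
\<close>

class complex_hilbert = banach +
  fixes scaleC :: "complex \<Rightarrow> 'a \<Rightarrow> 'a"  (infixr \<open>*\<^sub>C\<close> 75)
    and cinner :: "'a \<Rightarrow> 'a \<Rightarrow> complex"
  assumes scaleC_add_right: "c *\<^sub>C (x + y) = c *\<^sub>C x + c *\<^sub>C y"
    and scaleC_add_left: "(c + c') *\<^sub>C x = c *\<^sub>C x + c' *\<^sub>C x"
    and scaleC_scaleC: "c *\<^sub>C (c' *\<^sub>C x) = (c * c') *\<^sub>C x"
    and scaleR_scaleC: "scaleR r x = complex_of_real r *\<^sub>C x"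
    and cinner_commute: "cinner x y = cnj (cinner y x)"
    and cinner_add_left: "cinner (x + y) z = cinner x z + cinner y z"
    and cinner_scaleC_left: "cinner (c *\<^sub>C x) y = c * cinner x y"
    and cinner_self: "cinner x x = complex_of_real ((norm x)\<^sup>2)"

interpretation cvector:
  vector_space "scaleC :: complex \<Rightarrow> 'a \<Rightarrow> 'a::complex_hilbert"
  by unfold_locales
    (simp_all add: scaleC_add_right scaleC_add_left scaleC_scaleC
      scaleR_scaleC[of 1, simplified, symmetric])

text \<open>
  All sequences are indexed from 1: a basis \<open>(e\<^sub>n)\<^sub>n\<^sub>\<ge>\<^sub>1\<close> is a function on \<^typ>\<open>nat\<close>
  whose value at 0 is irrelevant. A space with such a basis is separable and
  infinite dimensional.
\<close>

definition orthonormal_basis :: "(nat \<Rightarrow> 'a::complex_hilbert) \<Rightarrow> bool" where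
  "orthonormal_basis e \<longleftrightarrow>
     (\<forall>i\<ge>1. \<forall>j\<ge>1. cinner (e i) (e j) = (if i = j then 1 else 0)) \<and>
     closure (cvector.span (e ` {1..})) = UNIV"

definition bounded_operator :: "('a::complex_hilbert \<Rightarrow> 'a) \<Rightarrow> bool" where
  "bounded_operator T \<longleftrightarrow> bounded_linear T \<and> (\<forall>c x. T (c *\<^sub>C x) = c *\<^sub>C T x)"

definition compact_operator :: "('a::complex_hilbert \<Rightarrow> 'a) \<Rightarrow> bool" where
  "compact_operator T \<longleftrightarrow> bounded_operator T \<and> compact (closure (T ` cball 0 1))"

text \<open>
  Boundedness of \<open>D\<close> is not required, so the sequence \<open>d\<close> need not be bounded. If \<open>d\<close> is
  bounded, the usual bounded diagonal operator is one such \<open>D\<close>.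
\<close>

definition diagonal_operator ::
    "(nat \<Rightarrow> 'a::complex_hilbert) \<Rightarrow> (nat \<Rightarrow> complex) \<Rightarrow> ('a \<Rightarrow> 'a) \<Rightarrow> bool" where
  "diagonal_operator e d D \<longleftrightarrow>
     Vector_Spaces.linear scaleC scaleC D \<and> (\<forall>n\<ge>1. D (e n) = d n *\<^sub>C e n)"

text \<open>
  The \<open>n\<close>-th block of the basis consists of the \<open>e (block_index n k)\<close> with \<open>1 \<le> k \<le> n\<close>;
  it is preceded by blocks of sizes \<open>1, \<dots>, n - 1\<close>.
\<close>

definition block_index :: "nat \<Rightarrow> nat \<Rightarrow> nat" where
  "block_index n k = n * (n - 1) div 2 + k"

text \<open>
  \<open>block_entry e T m n i j\<close> is the \<open>(i, j)\<close> entry of the \<open>(m, n)\<close> block of the matrix of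
  \<open>T\<close>; it is meaningful for \<open>1 \<le> i \<le> m\<close> and \<open>1 \<le> j \<le> n\<close>.
\<close>

definition block_entry ::
    "(nat \<Rightarrow> 'a::complex_hilbert) \<Rightarrow> ('a \<Rightarrow> 'a) \<Rightarrow> nat \<Rightarrow> nat \<Rightarrow> nat \<Rightarrow> nat \<Rightarrow> complex" where
  "block_entry e T m n i j = cinner (T (e (block_index n j))) (e (block_index m i))"

definition block_tridiagonal :: "(nat \<Rightarrow> 'a::complex_hilbert) \<Rightarrow> ('a \<Rightarrow> 'a) \<Rightarrow> bool" where
  "block_tridiagonal e T \<longleftrightarrow>
     (\<forall>m\<ge>1. \<forall>n\<ge>1. m > n + 1 \<or> n > m + 1 \<longrightarrow>
        (\<forall>i\<in>{1..m}. \<forall>j\<in>{1..n}. block_entry e T m n i j = 0))"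

definition zero_diagonal_blocks :: "(nat \<Rightarrow> 'a::complex_hilbert) \<Rightarrow> ('a \<Rightarrow> 'a) \<Rightarrow> bool" where
  "zero_diagonal_blocks e T \<longleftrightarrow>
     (\<forall>n\<ge>1. \<forall>i\<in>{1..n}. \<forall>j\<in>{1..n}. block_entry e T n n i j = 0)"

definition anderson_form ::
    "(nat \<Rightarrow> 'a::complex_hilbert) \<Rightarrow> ('a \<Rightarrow> 'a) \<Rightarrow> ('a \<Rightarrow> 'a) \<Rightarrow> bool" where
  "anderson_form e C Z \<longleftrightarrow>
     block_tridiagonal e C \<and> block_tridiagonal e Z \<and>
     zero_diagonal_blocks e C \<and> zero_diagonal_blocks e Z \<and>
     (\<exists>a b x y :: nat \<Rightarrow> nat \<Rightarrow> complex. \<forall>n\<ge>1.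
        (\<forall>i\<in>{1..n}. \<forall>j\<in>{1..n+1}.
           block_entry e C n (n+1) i j = (if j = i then a i n else 0) \<and>
           block_entry e Z n (n+1) i j = (if j = i + 1 then x i n else 0)) \<and>
        (\<forall>i\<in>{1..n+1}. \<forall>j\<in>{1..n}.
           block_entry e C (n+1) n i j = (if i = j + 1 then - b j n else 0) \<and>
           block_entry e Z (n+1) n i j = (if i = j then y j n else 0)))"

definition full_anderson_form ::
    "(nat \<Rightarrow> 'a::complex_hilbert) \<Rightarrow> ('a \<Rightarrow> 'a) \<Rightarrow> ('a \<Rightarrow> 'a) \<Rightarrow> bool" where
  "full_anderson_form e C Z \<longleftrightarrow>
     block_tridiagonal e C \<and> block_tridiagonal e Z \<and>
     zero_diagonal_blocks e C \<and> zero_diagonal_blocks e Z"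

definition full_anderson_form_diag ::
    "(nat \<Rightarrow> 'a::complex_hilbert) \<Rightarrow> ('a \<Rightarrow> 'a) \<Rightarrow> ('a \<Rightarrow> 'a) \<Rightarrow> bool" where
  "full_anderson_form_diag e C Z \<longleftrightarrow>
     block_tridiagonal e C \<and> block_tridiagonal e Z \<and> zero_diagonal_blocks e Z"

end

theory Submission
  imports Defs
begin

text \<open>
  Fix \<open>n\<close> and let \<open>P\<close> be the orthogonal projection onto the span of the first \<open>n\<close> blocks, so
  that \<open>d\<^sub>1 + \<dots> + d\<^sub>N\<close> with \<open>N = n (n + 1) / 2\<close> is the trace of \<open>P (C Z - Z C) P\<close>. The commutator
  \<open>(P C P) (P Z P) - (P Z P) (P C P)\<close> of finite matrices has trace zero, so only
  \<open>P C (1 - P) Z P - P Z (1 - P) C P\<close> contributes. Block tridiagonality reduces its trace to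
  the \<open>n\<close> diagonal entries belonging to the \<open>n\<close>-th block; writing \<open>Q\<close> for the projection onto
  block \<open>n + 1\<close>, the entry at \<open>k\<close> is
  \<open>\<langle>C Q Z e\<^sub>k, e\<^sub>k\<rangle> - \<langle>Z Q C e\<^sub>k, e\<^sub>k\<rangle>\<close> (\<open>sum_diagonal_commutator\<close>).

  Both terms are at most \<open>\<epsilon> \<parallel>Z\<parallel>\<close> once \<open>\<parallel>C w\<parallel> \<le> \<epsilon> \<parallel>w\<parallel>\<close> holds for \<open>w = Q Z e\<^sub>k\<close> and
  \<open>w = e\<^sub>k\<close>. For large \<open>n\<close> this follows from compactness, because block tridiagonality makes
  \<open>C w\<close> orthogonal to a long initial part of the basis (\<open>compact_operator_small\<close>). Hence
  \<open>d\<^sub>1 + \<dots> + d\<^sub>N \<le> 2 \<epsilon> \<parallel>Z\<parallel> n\<close> for large \<open>n\<close>, and the limit superior cannot be positive.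

  All three forms of the model make \<open>C\<close> and \<open>Z\<close> block tridiagonal, so this one argument
  excludes each of them.
\<close>

section \<open>Inner products and orthonormal systems\<close>

lemma cinner_add_right: "cinner x (y + z) = cinner x y + cinner x (z::'a::complex_hilbert)"
  by (metis cinner_commute cinner_add_left complex_cnj_add)

lemma cinner_scaleC_right: "cinner x (c *\<^sub>C y) = cnj c * cinner x (y::'a::complex_hilbert)"
  by (metis cinner_commute cinner_scaleC_left complex_cnj_mult)

lemma cinner_zero_left [simp]: "cinner 0 (y::'a::complex_hilbert) = 0"
  using cinner_add_left[of 0 0 y] by simp

lemma cinner_zero_right [simp]: "cinner (y::'a::complex_hilbert) 0 = 0"
  using cinner_add_right[of y 0 0] by simp

lemma cinner_diff_left: "cinner (x - y) z = cinner x z - cinner y (z::'a::complex_hilbert)"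
  using cinner_add_left[of "x - y" y z] by simp

lemma cinner_diff_right: "cinner z (x - y) = cinner z x - cinner z (y::'a::complex_hilbert)"
  using cinner_add_right[of z "x - y" y] by simp

lemma cinner_sum_left: "cinner (\<Sum>i\<in>F. f i) (z::'a::complex_hilbert) = (\<Sum>i\<in>F. cinner (f i) z)"
  by (induction F rule: infinite_finite_induct) (simp_all add: cinner_add_left)

lemma norm_cinner_le: "norm (cinner x y) \<le> norm x * norm (y::'a::complex_hilbert)"
proof (cases "y = 0")
  case False
  define r where "r = cinner x y"
  define s where "s = complex_of_real ((norm y)\<^sup>2)"
  \<comment> \<open>The squared norm of the component of \<open>x\<close> orthogonal to \<open>y\<close> is nonnegative.\<close>
  have s: "s \<noteq> 0" "cnj s = s" and ss: "cinner y y = s"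
    using False by (auto simp: s_def cinner_self)
  have "complex_of_real ((norm (x - (r / s) *\<^sub>C y))\<^sup>2)
      = cinner (x - (r / s) *\<^sub>C y) (x - (r / s) *\<^sub>C y)"
    by (simp only: cinner_self)
  also have "\<dots> = cinner x x - cnj r / s * r - r / s * cnj r + r / s * (cnj r / s) * s"
    using s cinner_commute[of y x]
    by (simp add: cinner_diff_left cinner_diff_right cinner_scaleC_left cinner_scaleC_right
        r_def[symmetric] ss algebra_simps)
  also have "\<dots> = cinner x x - r * cnj r / s"
    using s by (simp add: field_simps)
  also have "\<dots> = complex_of_real ((norm x)\<^sup>2 - (norm r)\<^sup>2 / (norm y)\<^sup>2)"
    by (simp add: s_def cinner_self complex_norm_square[symmetric])
  finally have "(norm (x - (r / s) *\<^sub>C y))\<^sup>2 = (norm x)\<^sup>2 - (norm r)\<^sup>2 / (norm y)\<^sup>2"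
    using of_real_eq_iff by blast
  hence "(norm r)\<^sup>2 / (norm y)\<^sup>2 \<le> (norm x)\<^sup>2"
    by (metis diff_ge_0_iff_ge zero_le_power2)
  hence "(norm r)\<^sup>2 \<le> (norm x * norm y)\<^sup>2"
    using False by (simp add: field_simps power_mult_distrib)
  thus ?thesis
    unfolding r_def by (rule power2_le_imp_le) simp
qed simp

lemma bounded_linear_cinner_left: "bounded_linear (\<lambda>x. cinner x (y::'a::complex_hilbert))"
proof (rule bounded_linear_intro)
  show "cinner (r *\<^sub>R x) y = r *\<^sub>R cinner x y" for r x
    by (simp add: scaleR_scaleC cinner_scaleC_left scaleR_conv_of_real)
qed (use norm_cinner_le in \<open>auto simp: cinner_add_left\<close>)

lemma bounded_linear_cinner_right: "bounded_linear (\<lambda>y. cinner x (y::'a::complex_hilbert))"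
proof (rule bounded_linear_intro[where K = "norm x"])
  show "cinner x (r *\<^sub>R y) = r *\<^sub>R cinner x y" for r y
    by (simp add: scaleR_scaleC cinner_scaleC_right scaleR_conv_of_real)
  show "norm (cinner x y) \<le> norm y * norm x" for y
    using norm_cinner_le[of x y] by (simp add: mult.commute)
qed (simp add: cinner_add_right)

lemma norm_basis:
  assumes "orthonormal_basis e" "k \<ge> 1"
  shows "norm (e k) = 1"
proof -
  have "cinner (e k) (e k) = 1"
    using assms by (simp add: orthonormal_basis_def)
  hence "(norm (e k))\<^sup>2 = 1"
    unfolding cinner_self of_real_eq_1_iff .
  thus ?thesis
    using norm_ge_zero[of "e k"] by (auto simp only: power2_eq_1_iff)
qed

text \<open>The vectors orthogonal to \<open>x\<close> form a closed subspace, here containing a dense one.\<close>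

lemma orthogonal_basis_imp_zero:
  assumes e: "orthonormal_basis e" and x: "\<And>j. j \<ge> 1 \<Longrightarrow> cinner x (e j) = 0"
  shows "x = 0"
proof -
  have span: "cinner x y = 0" if "y \<in> cvector.span (e ` {1..})" for y
    using that
    by (induction rule: cvector.span_induct_alt) (auto simp: cinner_add_right cinner_scaleC_right x)
  have "closed {y. cinner x y = 0}"
    by (intro closed_Collect_eq continuous_on_const
        linear_continuous_on[OF bounded_linear_cinner_right])
  hence "closure (cvector.span (e ` {1..})) \<subseteq> {y. cinner x y = 0}"
    using span by (intro closure_minimal) auto
  hence "cinner x x = 0"
    using e by (auto simp: orthonormal_basis_def)
  thus ?thesis by (simp add: cinner_self)
qed

definition basis_proj :: "(nat \<Rightarrow> 'a::complex_hilbert) \<Rightarrow> nat set \<Rightarrow> 'a \<Rightarrow> 'a" where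
  "basis_proj e F x = (\<Sum>j\<in>F. cinner x (e j) *\<^sub>C e j)"

lemma cinner_basis_proj:
  assumes "orthonormal_basis e" "finite F" "F \<subseteq> {1..}" "k \<ge> 1"
  shows "cinner (basis_proj e F x) (e k) = (if k \<in> F then cinner x (e k) else 0)"
proof -
  have "cinner (basis_proj e F x) (e k) = (\<Sum>j\<in>F. if k = j then cinner x (e j) else 0)"
    unfolding basis_proj_def cinner_sum_left
    using assms by (intro sum.cong) (auto simp: orthonormal_basis_def cinner_scaleC_left subset_iff)
  thus ?thesis using assms by simp
qed

lemma norm_basis_proj_le:
  assumes "orthonormal_basis e" "finite F" "F \<subseteq> {1..}"
  shows "norm (basis_proj e F x) \<le> norm x"
proof -
  define p where "p = basis_proj e F x"
  \<comment> \<open>As \<open>x - p\<close> is orthogonal to \<open>p\<close>, the squared norm of \<open>p\<close> is \<open>cinner p x\<close>.\<close>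
  have "cinner (x - p) (e j) = 0" if "j \<in> F" for j
    using that assms by (auto simp: cinner_diff_left p_def cinner_basis_proj subset_iff)
  hence "cinner (basis_proj e F x) (x - p) = 0"
    unfolding basis_proj_def cinner_sum_left
    by (intro sum.neutral ballI) (metis cinner_scaleC_left cinner_commute complex_cnj_zero mult_zero_right)
  hence "cinner p x = complex_of_real ((norm p)\<^sup>2)"
    by (simp add: cinner_diff_right cinner_self p_def)
  hence "(norm p)\<^sup>2 \<le> norm p * norm x"
    using norm_cinner_le[of p x] by (simp add: norm_power)
  thus ?thesis
    unfolding p_def[symmetric] by (cases "p = 0") (auto simp: power2_eq_square)
qed

lemma basis_proj_eq_self:
  assumes "orthonormal_basis e" "finite F" "F \<subseteq> {1..}"
    and "\<And>j. \<lbrakk>j \<ge> 1; j \<notin> F\<rbrakk> \<Longrightarrow> cinner x (e j) = 0"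
  shows "basis_proj e F x = x"
proof -
  have "x - basis_proj e F x = 0"
    using assms by (intro orthogonal_basis_imp_zero[OF assms(1)])
      (auto simp: cinner_diff_left cinner_basis_proj)
  thus ?thesis by simp
qed

lemma bounded_operator_basis_proj:
  assumes "bounded_operator T"
  shows "T (basis_proj e F x) = (\<Sum>j\<in>F. cinner x (e j) *\<^sub>C T (e j))"
proof -
  interpret T: bounded_linear T using assms by (simp add: bounded_operator_def)
  show ?thesis
    using assms by (simp add: basis_proj_def T.sum bounded_operator_def)
qed

section \<open>Smallness of compact operators\<close>

text \<open>
  If the estimate failed for every \<open>m\<close>, unit vectors witnessing this would have a subsequence
  of images converging to a vector of norm at least \<open>\<epsilon>\<close>; the limit would be orthogonal to all
  \<open>e\<^sub>j\<close>.
\<close>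

lemma compact_operator_small:
  assumes e: "orthonormal_basis e" and C: "compact_operator C" and eps: "\<epsilon> > 0"
  obtains m where "\<And>w. (\<And>j. j \<in> {1..m} \<Longrightarrow> cinner (C w) (e j) = 0) \<Longrightarrow> norm (C w) \<le> \<epsilon> * norm w"
proof -
  interpret C: bounded_linear C
    using C by (simp add: compact_operator_def bounded_operator_def)
  have "\<exists>m. \<forall>w. (\<forall>j\<in>{1..m}. cinner (C w) (e j) = 0) \<longrightarrow> norm (C w) \<le> \<epsilon> * norm w"
  proof (rule ccontr)
    assume "\<not> ?thesis"
    then obtain w where w0: "\<And>m j. j \<in> {1..m} \<Longrightarrow> cinner (C (w m)) (e j) = 0"
      and wbig: "\<And>m. norm (C (w m)) > \<epsilon> * norm (w m)"
      unfolding not_ex not_all not_imp not_le by metis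
    have wnz: "norm (w m) > 0" for m
      using wbig[of m] by (auto simp: C.zero)
    define y where "y m = C (w m /\<^sub>R norm (w m))" for m
    have y: "y m = C (w m) /\<^sub>R norm (w m)" for m
      by (simp add: y_def C.scaleR)
    have y0: "cinner (y m) (e j) = 0" if "j \<in> {1..m}" for m j
      using w0[OF that] by (simp add: y scaleR_scaleC cinner_scaleC_left)
    have ybig: "norm (y m) \<ge> \<epsilon>" for m
      using wbig[of m] wnz[of m] unfolding y norm_scaleR by (simp add: field_simps)
    have "y m \<in> C ` cball 0 1" for m
      unfolding y_def using wnz[of m] by (intro imageI) simp
    hence "\<forall>m. y m \<in> closure (C ` cball 0 1)"
      using closure_subset by blast
    moreover have "seq_compact (closure (C ` cball 0 1))"
      using C by (simp only: compact_operator_def compact_eq_seq_compact_metric)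
    ultimately obtain l r where r: "strict_mono (r :: nat \<Rightarrow> nat)" and l: "(y \<circ> r) \<longlonglongrightarrow> l"
      unfolding seq_compact_def by metis
    have "cinner l (e j) = 0" if "j \<ge> 1" for j
    proof -
      have "(\<lambda>m. cinner ((y \<circ> r) m) (e j)) \<longlonglongrightarrow> cinner l (e j)"
        by (rule bounded_linear.tendsto[OF bounded_linear_cinner_left l])
      moreover have "\<forall>\<^sub>F m in sequentially. cinner ((y \<circ> r) m) (e j) = 0"
        using eventually_ge_at_top[of j]
      proof eventually_elim
        case (elim m)
        thus ?case
          using that seq_suble[OF r, of m] unfolding o_apply by (intro y0) auto
      qed
      ultimately show ?thesis
        by (intro LIMSEQ_unique[OF _ tendsto_eventually])
    qed
    hence "l = 0" by (rule orthogonal_basis_imp_zero[OF e])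
    moreover have "norm l \<ge> \<epsilon>"
      using tendsto_norm[OF l] by (rule LIMSEQ_le_const) (use ybig in auto)
    ultimately show False using eps by simp
  qed
  thus ?thesis using that by blast
qed

section \<open>Truncated traces of block tridiagonal commutators\<close>

definition tri :: "nat \<Rightarrow> nat" where
  "tri n = n * (n + 1) div 2"

lemma tri_Suc: "tri (Suc n) = tri n + Suc n"
proof -
  have "Suc n * (Suc n + 1) = n * (n + 1) + 2 * Suc n" by simp
  thus ?thesis unfolding tri_def by presburger
qed

lemma tri_0: "tri 0 = 0"
  by (simp add: tri_def)

lemma le_tri: "n \<le> tri n"
  by (induction n) (auto simp: tri_Suc)

lemma tri_mono: "m \<le> n \<Longrightarrow> tri m \<le> tri n"
  by (induction n rule: dec_induct) (auto simp: tri_Suc)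

lemma block_index_Suc: "block_index (Suc n) k = tri n + k"
  by (simp add: block_index_def tri_def mult.commute)

lemma block_index_exists:
  assumes "i \<ge> 1"
  obtains n k where "k \<in> {1..Suc n}" "i = block_index (Suc n) k"
proof -
  define p where "p = (LEAST p. i \<le> tri p)"
  have p: "i \<le> tri p"
    unfolding p_def by (rule LeastI[of _ i]) (rule le_tri)
  with assms obtain n where n: "p = Suc n"
    by (cases p) (auto simp: tri_0)
  have "tri n < i"
    using not_less_Least[of n "\<lambda>p. i \<le> tri p"] n unfolding p_def by simp
  with p n show ?thesis
    by (intro that[of "i - tri n" n]) (auto simp: block_index_Suc tri_Suc)
qed

text \<open>
  Block tridiagonality enters in this form, with indices compared to triangular numbers
  instead of block coordinates: if \<open>i\<close> lies in block \<open>n\<close> or earlier and \<open>j\<close> beyond block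
  \<open>n + 1\<close>, then their blocks differ by at least two.
\<close>

lemma block_tridiagonal_far:
  assumes T: "block_tridiagonal e T" and "i \<ge> 1" "i \<le> tri n" "j > tri (Suc n)"
  shows "cinner (T (e i)) (e j) = 0" "cinner (T (e j)) (e i) = 0"
proof -
  obtain p k where k: "k \<in> {1..Suc p}" "i = block_index (Suc p) k"
    using block_index_exists assms by blast
  obtain q l where l: "l \<in> {1..Suc q}" "j = block_index (Suc q) l"
    using block_index_exists assms by (metis less_one not_less less_nat_zero_code)
  have "tri p < tri n"
    using k assms by (auto simp: block_index_Suc)
  hence "p < n" using tri_mono[of n p] by linarith
  moreover have "tri (Suc n) < tri (Suc q)"
    using l assms by (auto simp: block_index_Suc tri_Suc)
  hence "Suc n < Suc q" using tri_mono[of "Suc q" "Suc n"] by linarith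
  ultimately have "Suc p + 1 < Suc q" by simp
  thus "cinner (T (e i)) (e j) = 0" "cinner (T (e j)) (e i) = 0"
    using T k l unfolding block_tridiagonal_def block_entry_def by auto
qed

lemma block_tridiagonal_far_proj:
  assumes S: "bounded_operator S" "block_tridiagonal e S"
    and i: "i \<ge> 1" "i \<le> tri n" and F: "F \<subseteq> {tri (Suc n)<..}"
  shows "cinner (S (basis_proj e F x)) (e i) = 0"
  unfolding bounded_operator_basis_proj[OF S(1)] cinner_sum_left cinner_scaleC_left
  using F i by (intro sum.neutral ballI) (auto simp: block_tridiagonal_far(2)[OF S(2)] subset_iff)

text \<open>
  Expanding \<open>T e\<^sub>k\<close> in the basis, the indices within the first blocks are separated from those
  in the next block; farther ones do not occur.
\<close>

lemma cinner_product_split: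
  assumes e: "orthonormal_basis e" and S: "bounded_operator S"
    and T: "block_tridiagonal e T" and k: "k \<ge> 1" "k \<le> tri n"
  shows "cinner (S (T (e k))) (e k)
    = (\<Sum>j\<in>{1..tri n}. cinner (T (e k)) (e j) * cinner (S (e j)) (e k))
      + cinner (S (basis_proj e {tri n<..tri (Suc n)} (T (e k)))) (e k)"
proof -
  have "basis_proj e {1..tri (Suc n)} (T (e k)) = T (e k)"
    using block_tridiagonal_far(1)[OF T k] by (intro basis_proj_eq_self[OF e]) auto
  hence "cinner (S (T (e k))) (e k)
      = (\<Sum>j\<in>{1..tri (Suc n)}. cinner (T (e k)) (e j) * cinner (S (e j)) (e k))"
    using bounded_operator_basis_proj[OF S, of e "{1..tri (Suc n)}" "T (e k)"]
    by (simp add: cinner_sum_left cinner_scaleC_left)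
  also have "{1..tri (Suc n)} = {1..tri n} \<union> {tri n<..tri (Suc n)}"
    by (auto simp: tri_Suc)
  also have "(\<Sum>j\<in>\<dots>. cinner (T (e k)) (e j) * cinner (S (e j)) (e k))
      = (\<Sum>j\<in>{1..tri n}. cinner (T (e k)) (e j) * cinner (S (e j)) (e k))
        + (\<Sum>j\<in>{tri n<..tri (Suc n)}. cinner (T (e k)) (e j) * cinner (S (e j)) (e k))"
    by (intro sum.union_disjoint) auto
  finally show ?thesis
    by (simp add: bounded_operator_basis_proj[OF S] cinner_sum_left cinner_scaleC_left)
qed

text \<open>
  The double sums over the square of the first blocks agree for \<open>C Z\<close> and \<open>Z C\<close> after
  exchanging the summation indices. What is left couples the next block to the last of the
  first blocks only.
\<close>

lemma sum_diagonal_commutator: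
  fixes e :: "nat \<Rightarrow> 'a::complex_hilbert"
  assumes e: "orthonormal_basis e"
    and C: "bounded_operator C" "block_tridiagonal e C"
    and Z: "bounded_operator Z" "block_tridiagonal e Z"
  shows "(\<Sum>k = 1..tri (Suc n). cinner (C (Z (e k)) - Z (C (e k))) (e k))
    = (\<Sum>k\<in>{tri n<..tri (Suc n)}.
        cinner (C (basis_proj e {tri (Suc n)<..tri (Suc (Suc n))} (Z (e k)))) (e k)
        - cinner (Z (basis_proj e {tri (Suc n)<..tri (Suc (Suc n))} (C (e k)))) (e k))"
    (is "_ = sum ?r _")
proof -
  let ?I = "{1..tri (Suc n)}"
  let ?g = "\<lambda>k j. cinner (Z (e k)) (e j) * cinner (C (e j)) (e k)"
  have "(\<Sum>k\<in>?I. cinner (C (Z (e k)) - Z (C (e k))) (e k))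
      = (\<Sum>k\<in>?I. (\<Sum>j\<in>?I. ?g k j) - (\<Sum>j\<in>?I. ?g j k) + ?r k)"
    by (intro sum.cong refl)
      (simp add: cinner_diff_left cinner_product_split[OF e C(1) Z(2), where n = "Suc n"]
        cinner_product_split[OF e Z(1) C(2), where n = "Suc n"] mult.commute)
  also have "\<dots> = (\<Sum>k\<in>?I. \<Sum>j\<in>?I. ?g k j) - (\<Sum>k\<in>?I. \<Sum>j\<in>?I. ?g j k) + sum ?r ?I"
    by (simp add: sum.distrib sum_subtractf)
  also have "(\<Sum>k\<in>?I. \<Sum>j\<in>?I. ?g j k) = (\<Sum>k\<in>?I. \<Sum>j\<in>?I. ?g k j)"
    by (rule sum.swap)
  also have "sum ?r ?I = sum ?r {tri n<..tri (Suc n)}"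
  proof (rule sum.mono_neutral_right)
    show "\<forall>k\<in>?I - {tri n<..tri (Suc n)}. ?r k = 0"
    proof
      fix k assume "k \<in> ?I - {tri n<..tri (Suc n)}"
      hence "k \<ge> 1" "k \<le> tri n" by auto
      thus "?r k = 0"
        by (simp add: block_tridiagonal_far_proj[OF C, where n = n]
            block_tridiagonal_far_proj[OF Z, where n = n] greaterThanAtMost_def)
    qed
  qed auto
  finally show ?thesis by simp
qed

section \<open>The limit superior\<close>

text \<open>
  Let \<open>N\<close> be the number of blocks summed over and \<open>k\<close> an index in block \<open>N\<close>. The hypothesis
  on \<open>C\<close> is applied to \<open>e\<^sub>k\<close> and to vectors from block \<open>N + 1\<close>, whose images are
  orthogonal to the first \<open>N - 2\<close> and \<open>N - 1\<close> blocks. These contain at least \<open>m\<close> basis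
  vectors as soon as \<open>N \<ge> m + 2\<close>, hence \<open>N = m + n + 2\<close>.
\<close>

lemma norm_sum_diagonal_commutator_le:
  fixes e :: "nat \<Rightarrow> 'a::complex_hilbert"
  assumes e: "orthonormal_basis e"
    and C: "bounded_operator C" "block_tridiagonal e C"
    and Z: "bounded_operator Z" "block_tridiagonal e Z"
    and B: "\<And>x. norm (Z x) \<le> B * norm x" and "B \<ge> 0" and "\<epsilon> \<ge> 0"
    and m: "\<And>w. (\<And>j. j \<in> {1..m} \<Longrightarrow> cinner (C w) (e j) = 0) \<Longrightarrow> norm (C w) \<le> \<epsilon> * norm w"
  shows "norm (\<Sum>k = 1..tri (Suc (Suc (m + n))). cinner (C (Z (e k)) - Z (C (e k))) (e k))
    \<le> real (Suc (Suc (m + n))) * (2 * B * \<epsilon>)"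
proof -
  let ?s = "Suc (m + n)"
  let ?F = "{tri (Suc ?s)<..tri (Suc (Suc ?s))}"
  have F: "finite ?F" "?F \<subseteq> {1..}" by auto
  have "norm (cinner (C (basis_proj e ?F (Z (e k)))) (e k)
      - cinner (Z (basis_proj e ?F (C (e k)))) (e k)) \<le> 2 * B * \<epsilon>"
    if k: "k \<in> {tri ?s<..tri (Suc ?s)}" for k
  proof -
    have ek: "norm (e k) = 1" using k by (intro norm_basis[OF e]) auto
    have m_le: "m \<le> tri (m + n)" "m \<le> tri ?s"
      using le_tri[of "m + n"] le_tri[of ?s] by linarith+
    have "norm (cinner (C (basis_proj e ?F (Z (e k)))) (e k)) \<le> norm (C (basis_proj e ?F (Z (e k))))"
      using norm_cinner_le[of _ "e k"] by (simp add: ek)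
    also have "\<dots> \<le> \<epsilon> * norm (basis_proj e ?F (Z (e k)))"
      using m_le by (intro m block_tridiagonal_far_proj[OF C, where n = ?s]) auto
    also have "\<dots> \<le> \<epsilon> * B"
      using norm_basis_proj_le[OF e F, of "Z (e k)"] B[of "e k"] \<open>\<epsilon> \<ge> 0\<close>
      by (intro mult_left_mono) (auto simp: ek)
    finally have 1: "norm (cinner (C (basis_proj e ?F (Z (e k)))) (e k)) \<le> B * \<epsilon>"
      by (simp add: mult.commute)
    have "norm (cinner (Z (basis_proj e ?F (C (e k)))) (e k)) \<le> norm (Z (basis_proj e ?F (C (e k))))"
      using norm_cinner_le[of _ "e k"] by (simp add: ek)
    also have "\<dots> \<le> B * norm (basis_proj e ?F (C (e k)))"
      by (rule B)
    also have "\<dots> \<le> B * norm (C (e k))"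
      using \<open>B \<ge> 0\<close> by (intro mult_left_mono norm_basis_proj_le[OF e F])
    also have "norm (C (e k)) \<le> \<epsilon> * norm (e k)"
      using k m_le by (intro m block_tridiagonal_far(2)[OF C(2), where n = "m + n"]) auto
    hence "B * norm (C (e k)) \<le> B * \<epsilon>"
      using \<open>B \<ge> 0\<close> by (intro mult_left_mono) (auto simp: ek)
    finally have 2: "norm (cinner (Z (basis_proj e ?F (C (e k)))) (e k)) \<le> B * \<epsilon>" .
    show ?thesis
      using norm_triangle_ineq4[of "cinner (C (basis_proj e ?F (Z (e k)))) (e k)"
          "cinner (Z (basis_proj e ?F (C (e k)))) (e k)"] 1 2 by linarith
  qed
  hence "norm (\<Sum>k = 1..tri (Suc ?s). cinner (C (Z (e k)) - Z (C (e k))) (e k))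
      \<le> of_nat (card {tri ?s<..tri (Suc ?s)}) * (2 * B * \<epsilon>)"
    unfolding sum_diagonal_commutator[OF e C Z] by (rule sum_norm_bound)
  thus ?thesis by (simp add: tri_Suc)
qed

lemma limsup_block_tridiagonal_commutator:
  fixes e :: "nat \<Rightarrow> 'a::complex_hilbert" and d :: "nat \<Rightarrow> real"
  assumes e: "orthonormal_basis e"
    and C: "compact_operator C" "block_tridiagonal e C"
    and Z: "bounded_operator Z" "block_tridiagonal e Z"
    and d: "\<And>k. k \<ge> 1 \<Longrightarrow> C (Z (e k)) - Z (C (e k)) = complex_of_real (d k) *\<^sub>C e k"
  shows "limsup (\<lambda>n. ereal (1 / real n * (\<Sum>k = 1..n * (n + 1) div 2. d k))) \<le> 0"
proof (rule ereal_le_epsilon2)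
  fix \<delta> :: real assume \<delta>: "\<delta> > 0"
  have C': "bounded_operator C" using C by (simp add: compact_operator_def)
  obtain B where B: "B > 0" "\<And>x. norm (Z x) \<le> B * norm x"
    using Z(1) bounded_linear.pos_bounded[of Z] unfolding bounded_operator_def
    by (metis mult.commute)
  define \<epsilon> where "\<epsilon> = \<delta> / (2 * B)"
  have \<epsilon>: "\<epsilon> > 0" "2 * B * \<epsilon> = \<delta>" using \<delta> B by (auto simp: \<epsilon>_def)
  obtain m where m: "\<And>w. (\<And>j. j \<in> {1..m} \<Longrightarrow> cinner (C w) (e j) = 0) \<Longrightarrow> norm (C w) \<le> \<epsilon> * norm w"
    using compact_operator_small[OF e C(1) \<epsilon>(1)] by blast
  have "\<forall>\<^sub>F n in sequentially. ereal (1 / real n * (\<Sum>k = 1..n * (n + 1) div 2. d k)) \<le> ereal \<delta>"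
    using eventually_ge_at_top[of "Suc (Suc m)"]
  proof eventually_elim
    case (elim n)
    then obtain r where r: "n = Suc (Suc (m + r))"
      by (auto dest: le_Suc_ex)
    have "complex_of_real (\<Sum>k = 1..tri n. d k)
        = (\<Sum>k = 1..tri n. cinner (C (Z (e k)) - Z (C (e k))) (e k))"
      unfolding of_real_sum
      using e by (intro sum.cong) (auto simp: d cinner_scaleC_left orthonormal_basis_def)
    moreover have "norm (\<Sum>k = 1..tri n. cinner (C (Z (e k)) - Z (C (e k))) (e k))
        \<le> real n * (2 * B * \<epsilon>)"
      unfolding r using B(1) \<epsilon>(1) by (intro norm_sum_diagonal_commutator_le[OF e C' C(2) Z B(2)] m) auto
    ultimately have "norm (complex_of_real (\<Sum>k = 1..tri n. d k)) \<le> real n * \<delta>"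
      by (simp only: \<epsilon>(2))
    hence "(\<Sum>k = 1..tri n. d k) \<le> real n * \<delta>"
      unfolding norm_of_real by simp
    thus ?case
      using elim by (simp add: tri_def field_simps)
  qed
  hence "limsup (\<lambda>n. ereal (1 / real n * (\<Sum>k = 1..n * (n + 1) div 2. d k))) \<le> ereal \<delta>"
    by (rule Limsup_bounded)
  thus "limsup (\<lambda>n. ereal (1 / real n * (\<Sum>k = 1..n * (n + 1) div 2. d k))) \<le> 0 + ereal \<delta>"
    by simp
qed

theorem corollary3p5:
  fixes e :: "nat \<Rightarrow> 'a::complex_hilbert" and d :: "nat \<Rightarrow> real" and D :: "'a \<Rightarrow> 'a"
  assumes "orthonormal_basis e"
    and "\<And>n. n \<ge> 1 \<Longrightarrow> d n > 0"
    and "limsup (\<lambda>n. ereal (1 / real n * (\<Sum>k = 1..n * (n + 1) div 2. d k))) > 0"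
    and "diagonal_operator e (\<lambda>n. complex_of_real (d n)) D"
  shows "(\<nexists>C Z. compact_operator C \<and> bounded_operator Z \<and>
             D = (\<lambda>x. C (Z x) - Z (C x)) \<and> anderson_form e C Z) \<and>
         (\<nexists>C Z. compact_operator C \<and> bounded_operator Z \<and>
             D = (\<lambda>x. C (Z x) - Z (C x)) \<and> full_anderson_form e C Z) \<and>
         (\<nexists>C Z. compact_operator C \<and> bounded_operator Z \<and>
             D = (\<lambda>x. C (Z x) - Z (C x)) \<and> full_anderson_form_diag e C Z)"
proof -
  have "False" if "compact_operator C" "bounded_operator Z" "D = (\<lambda>x. C (Z x) - Z (C x))"
    "block_tridiagonal e C" "block_tridiagonal e Z" for C Z
  proof -
    have "C (Z (e k)) - Z (C (e k)) = complex_of_real (d k) *\<^sub>C e k" if "k \<ge> 1" for k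
      using assms(4) that unfolding \<open>D = _\<close> diagonal_operator_def by blast
    thus False
      using limsup_block_tridiagonal_commutator[OF assms(1) that(1,4,2,5), of d] assms(3) by simp
  qed
  thus ?thesis
    unfolding anderson_form_def full_anderson_form_def full_anderson_form_diag_def by blast
qed

end
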